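(* Let $H$ be an infinite-dimensional complex Hilbert space and let $\varphi: B(H)\to B(H)$ be an additive map whose range contains $F_2(H)$. Suppose that $$H_{\varphi(T)\varphi(S)^{*}}(\{\lambda\}) = H_{TS^{*}}(\{\lambda\}) \quad \text{for all } T,S\in B(H) \text{ and all } \lambda\in\mathbb{C}.$$ Then there exist a unitary operator $V\in B(H)$ and a nonzero scalar $\mu\in\mathbb{C}$ such that $\varphi(T)=\mu T V^{*}$ for all $T\in B(H)$.
   Context: $B(H)$ denotes the algebra of bounded linear operators on $H$, and $T^*$ the Hilbert-space adjoint of $T$. $F_2(H)$ is the set of operators in $B(H)$ of rank at most two. For $T\in B(H)$ and $x\in H$, the local resolvent set $\rho_T(x)$ is the union of all open sets $U\subseteq\mathbb{C}$ for which there is an analytic $f:U\to H$ with $(\mu I-T)f(\mu)=x$ for all $\mu\in U$; the local spectrum is $\sigma_T(x)=\mathbb{C}\setminus\rho_T(x)$. For $F\subseteq\mathbb{C}$, the local spectral subspace is $H_T(F)=\{x\in H: \sigma_T(x)\subseteq F\}$. *)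

theory Defs
  imports "HOL-Analysis.Analysis"
begin

text \<open>Complex Hilbert spaces.  HOL-Analysis only provides real inner product spaces,
so a complex Hilbert space is a real Hilbert space (class real_inner + complete_space,
giving norm, topology, completeness) equipped with a complex scalar multiplication
extending the real one, for which multiplication by the imaginary unit is an isometry
of the real inner product.  The complex inner product is recovered below as cinner.\<close>

class complex_hilbert = real_inner + complete_space +
  fixes scaleC :: "complex \<Rightarrow> 'a \<Rightarrow> 'a"
  assumes scaleC_add_right: "scaleC a (x + y) = scaleC a x + scaleC a y"
    and scaleC_add_left: "scaleC (a + b) x = scaleC a x + scaleC b x"
    and scaleC_scaleC: "scaleC a (scaleC b x) = scaleC (a * b) x"
    and scaleC_of_real: "scaleC (of_real r) x = scaleR r x"
    and inner_scaleC_ii: "inner (scaleC \<i> x) (scaleC \<i> y) = inner x y"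

text \<open>Complex inner product (conjugate-linear in the first, linear in the second argument).\<close>
definition cinner :: "'a::complex_hilbert \<Rightarrow> 'a \<Rightarrow> complex" where
  "cinner x y = Complex (inner x y) (inner (scaleC \<i> x) y)"

definition cspan :: "'a::complex_hilbert set \<Rightarrow> 'a set" where
  "cspan S = {(\<Sum>s\<in>F. scaleC (c s) s) | F c. finite F \<and> F \<subseteq> S}"

definition infinite_dimensional :: "'a::complex_hilbert itself \<Rightarrow> bool" where
  "infinite_dimensional _ \<longleftrightarrow> (\<forall>S::'a set. finite S \<longrightarrow> cspan S \<noteq> UNIV)"

definition bounded_op :: "('a::complex_hilbert \<Rightarrow> 'a) \<Rightarrow> bool" where
  "bounded_op T \<longleftrightarrow> bounded_linear T \<and> (\<forall>c x. T (scaleC c x) = scaleC c (T x))"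

definition hadj :: "('a::complex_hilbert \<Rightarrow> 'a) \<Rightarrow> ('a \<Rightarrow> 'a)" where
  "hadj T = (THE S. \<forall>x y. cinner (T x) y = cinner x (S y))"

definition unitary :: "('a::complex_hilbert \<Rightarrow> 'a) \<Rightarrow> bool" where
  "unitary V \<longleftrightarrow> bounded_op V \<and> hadj V \<circ> V = id \<and> V \<circ> hadj V = id"

definition rank_le2 :: "('a::complex_hilbert \<Rightarrow> 'a) \<Rightarrow> bool" where
  "rank_le2 F \<longleftrightarrow> bounded_op F \<and> (\<exists>u v. range F \<subseteq> cspan {u, v})"

definition analytic_vec_on :: "(complex \<Rightarrow> 'a::complex_hilbert) \<Rightarrow> complex set \<Rightarrow> bool" where
  "analytic_vec_on f U \<longleftrightarrow>
     (\<forall>\<mu>\<in>U. \<exists>v. ((\<lambda>z. scaleC (inverse (z - \<mu>)) (f z - f \<mu>)) \<longlongrightarrow> v) (at \<mu>))"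

definition local_resolvent :: "('a::complex_hilbert \<Rightarrow> 'a) \<Rightarrow> 'a \<Rightarrow> complex set" where
  "local_resolvent T x = \<Union>{U. open U \<and> (\<exists>f. analytic_vec_on f U \<and>
       (\<forall>\<mu>\<in>U. scaleC \<mu> (f \<mu>) - T (f \<mu>) = x))}"

definition local_spectrum :: "('a::complex_hilbert \<Rightarrow> 'a) \<Rightarrow> 'a \<Rightarrow> complex set" where
  "local_spectrum T x = - local_resolvent T x"

definition local_spectral_subspace :: "('a::complex_hilbert \<Rightarrow> 'a) \<Rightarrow> complex set \<Rightarrow> 'a set" where
  "local_spectral_subspace T F = {x. local_spectrum T x \<subseteq> F}"

end

theory Submission
  imports Defs
begin

text \<open>Write \<open>x \<otimes> u\<close> for the rank-one operator sending \<open>z\<close> to \<open>\<langle>u, z\<rangle> x\<close>.  Its local spectral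
  subspace at \<open>l \<noteq> 0\<close> is the line through \<open>x\<close> if \<open>l = \<langle>u, x\<rangle>\<close>, and zero otherwise.
  If \<open>\<phi> T = x \<otimes> u\<close>, then testing the hypothesis against rank-one \<open>S\<close> places the range of \<open>T\<close> in
  the line through \<open>x\<close>, so \<open>T = x \<otimes> u'\<close>, and since \<open>(x \<otimes> u) (\<phi> S)\<^sup>* = x \<otimes> \<phi> S u\<close>, comparing
  eigenvalues gives \<open>\<langle>\<phi> S u, x\<rangle> = \<langle>S u', x\<rangle>\<close> for every \<open>S\<close>.
  Additivity in \<open>x\<close> shows that \<open>u'\<close> does not depend on \<open>x\<close>; taking \<open>S = I\<close> yields \<open>u' = \<phi> I u\<close>, hence
  \<open>\<phi> S = S (\<phi> I)\<close>.  Substituting \<open>S = x \<otimes> u'\<close> shows that \<open>\<phi> I\<close> is an isometry, and the injectivity of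
  \<open>\<phi>\<close> that it is onto.\<close>

section \<open>Complex Hilbert spaces\<close>

lemma scaleC_1 [simp]: "scaleC 1 x = x"
  using scaleC_of_real[of 1 x] by simp

lemma scaleC_0_left [simp]: "scaleC 0 x = 0"
  using scaleC_of_real[of 0 x] by simp

lemma scaleC_0_right [simp]: "scaleC c 0 = 0"
  using scaleC_add_right[of c 0 0] by simp

lemma scaleC_minus_left: "scaleC (- c) x = - scaleC c x"
  using scaleC_add_left[of c "- c" x] by (simp add: eq_neg_iff_add_eq_0 add.commute)

lemma scaleC_diff_left: "scaleC (a - b) x = scaleC a x - scaleC b x"
  using scaleC_add_left[of a "- b" x] by (simp add: scaleC_minus_left)

lemma scaleC_decompose: "scaleC c x = Re c *\<^sub>R x + Im c *\<^sub>R scaleC \<i> x"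
proof -
  have "scaleC c x = scaleC (of_real (Re c) + of_real (Im c) * \<i>) x"
    by (metis complex_eq mult.commute)
  then show ?thesis
    by (simp only: scaleC_add_left scaleC_scaleC[symmetric] scaleC_of_real)
qed

lemma scaleC_eq_0_iff: "scaleC c x = 0 \<longleftrightarrow> c = 0 \<or> x = 0"
proof -
  have "x = 0" if "scaleC c x = 0" "c \<noteq> 0"
    using scaleC_scaleC[of "inverse c" c x] that by simp
  then show ?thesis by auto
qed

lemma inner_scaleC_ii_left: "inner (scaleC \<i> x) y = - inner x (scaleC \<i> y)"
  using inner_scaleC_ii[of x "scaleC \<i> y"]
  by (simp add: scaleC_scaleC scaleC_minus_left)

lemma cnj_cinner: "cnj (cinner x y) = cinner y x"
  using inner_scaleC_ii_left[of x y]
  by (simp add: cinner_def complex_eq_iff inner_commute)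

lemma cinner_add_right: "cinner x (y + z) = cinner x y + cinner x z"
  by (simp add: cinner_def complex_eq_iff inner_add_right)

lemma cinner_scaleC_right: "cinner x (scaleC c y) = c * cinner x y"
  using inner_scaleC_ii[of x y] inner_scaleC_ii_left[of x y]
  by (simp add: cinner_def complex_eq_iff scaleC_decompose[of c y] inner_add_right)

lemma cinner_scaleC_left: "cinner (scaleC c x) y = cnj c * cinner x y"
  by (metis cinner_scaleC_right cnj_cinner complex_cnj_mult)

lemma cinner_add_left: "cinner (x + y) z = cinner x z + cinner y z"
  by (metis cinner_add_right cnj_cinner complex_cnj_add)

lemma cinner_diff_right: "cinner x (y - z) = cinner x y - cinner x z"
  using cinner_add_right[of x "y - z" z] by simp

lemma cinner_diff_left: "cinner (x - y) z = cinner x z - cinner y z"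
  using cinner_add_left[of "x - y" y z] by simp

lemma cinner_0_right [simp]: "cinner x 0 = 0"
  using cinner_diff_right[of x 0 0] by simp

lemma cinner_0_left [simp]: "cinner 0 x = 0"
  using cinner_diff_left[of 0 0 x] by simp

lemma Re_cinner: "Re (cinner x y) = inner x y"
  by (simp add: cinner_def)

lemma cinner_self_eq_0 [simp]: "cinner x x = 0 \<longleftrightarrow> x = 0"
  by (metis Re_cinner cinner_0_right inner_eq_zero_iff zero_complex.sel(1))

lemma cinner_ext_left:
  assumes "\<And>z. cinner x z = cinner y z"
  shows "x = y"
  using assms[of "x - y"] cinner_self_eq_0[of "x - y"] by (simp add: cinner_diff_left)

lemma cinner_ext_right:
  assumes "\<And>z. cinner z x = cinner z y"
  shows "x = y"
  using assms[of "x - y"] cinner_self_eq_0[of "x - y"] by (simp add: cinner_diff_right)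

lemma norm_scaleC_ii [simp]: "norm (scaleC \<i> x) = norm x"
  by (simp add: norm_eq_sqrt_inner inner_scaleC_ii)

lemma norm_scaleC_le: "norm (scaleC c x) \<le> 2 * cmod c * norm x"
proof -
  have "norm (scaleC c x) \<le> \<bar>Re c\<bar> * norm x + \<bar>Im c\<bar> * norm x"
    using norm_triangle_ineq[of "Re c *\<^sub>R x" "Im c *\<^sub>R scaleC \<i> x"]
    by (simp add: scaleC_decompose[of c x])
  also have "\<dots> \<le> cmod c * norm x + cmod c * norm x"
    by (intro add_mono mult_right_mono abs_Re_le_cmod abs_Im_le_cmod) auto
  finally show ?thesis by (simp add: algebra_simps)
qed

lemma cmod_cinner_le: "cmod (cinner x y) \<le> 2 * norm x * norm y"
proof -
  have "cmod (cinner x y) \<le> \<bar>inner x y\<bar> + \<bar>inner (scaleC \<i> x) y\<bar>"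
    using cmod_le[of "cinner x y"] by (simp add: cinner_def)
  also have "\<dots> \<le> norm x * norm y + norm (scaleC \<i> x) * norm y"
    by (intro add_mono Cauchy_Schwarz_ineq2)
  finally show ?thesis by simp
qed

lemma tendsto_cinner:
  assumes "(f \<longlongrightarrow> v) F"
  shows "((\<lambda>z. cinner w (f z)) \<longlongrightarrow> cinner w v) F"
  unfolding cinner_def using assms by (intro tendsto_intros)

lemma tendsto_scaleC_left:
  assumes "(c \<longlongrightarrow> d) F"
  shows "((\<lambda>z. scaleC (c z) x) \<longlongrightarrow> scaleC d x) F"
proof -
  have "((\<lambda>z. Re (c z) *\<^sub>R x + Im (c z) *\<^sub>R scaleC \<i> x) \<longlongrightarrow> Re d *\<^sub>R x + Im d *\<^sub>R scaleC \<i> x) F"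
    using assms by (intro tendsto_intros)
  then show ?thesis by (simp only: scaleC_decompose[symmetric])
qed

lemma tendsto_scaleC_zero:
  assumes "(c \<longlongrightarrow> 0) F" "(f \<longlongrightarrow> v) F"
  shows "((\<lambda>z. scaleC (c z) (f z)) \<longlongrightarrow> 0) F"
proof (rule Lim_null_comparison)
  show "\<forall>\<^sub>F z in F. norm (scaleC (c z) (f z)) \<le> 2 * cmod (c z) * norm (f z)"
    by (simp add: norm_scaleC_le)
  show "((\<lambda>z. 2 * cmod (c z) * norm (f z)) \<longlongrightarrow> 0) F"
    using tendsto_mult[OF tendsto_mult[OF tendsto_const[of 2] tendsto_norm[OF assms(1)]]
        tendsto_norm[OF assms(2)]]
    by simp
qed

section \<open>Riesz representation and adjoints\<close>

text \<open>The representing vector is the minimiser of \<open>J x = \<parallel>x\<parallel>\<^sup>2 - 2 f x\<close>; the parallelogram law makes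
  minimising sequences Cauchy.\<close>

lemma riesz_representation:
  fixes f :: "'a::{real_inner,complete_space} \<Rightarrow> real"
  assumes f: "bounded_linear f"
  shows "\<exists>v. \<forall>x. f x = inner v x"
proof -
  interpret f: bounded_linear f by fact
  define J where "J x = inner x x - 2 * f x" for x
  obtain K where K: "\<And>x. norm (f x) \<le> norm x * K"
    using f.bounded by blast
  have lower: "- K\<^sup>2 \<le> J x" for x
  proof -
    \<comment> \<open>Completing the square: \<open>J x\<close> is at least
      \<open>(norm x - K)\<^sup>2 - K\<^sup>2\<close>.\<close>
    have "0 \<le> (norm x - K)\<^sup>2" by simp
    moreover have "f x \<le> norm x * K" using K[of x] by simp
    ultimately show ?thesis
      by (simp add: J_def power2_norm_eq_inner[symmetric] power2_diff)
  qed
  define m where "m = Inf (range J)"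
  have bdd: "bdd_below (range J)" using lower by (rule bdd_belowI2)
  have m_le: "m \<le> J x" for x unfolding m_def using bdd by (auto intro: cInf_lower)
  have "\<exists>x. J x < m + inverse (Suc n)" for n
    using cInf_lessD[of "range J" "m + inverse (Suc n)"] by (auto simp: m_def)
  then obtain X where X: "\<And>n. J (X n) < m + inverse (Suc n)" by metis
  have parallelogram: "(norm (x - y))\<^sup>2 \<le> 2 * (J x - m) + 2 * (J y - m)" for x y
  proof -
    \<comment> \<open>The linear parts of \<open>J\<close> cancel, leaving the parallelogram law; at
      the midpoint \<open>J\<close> is still at least \<open>m\<close>.\<close>
    have "(norm (x - y))\<^sup>2 = 2 * J x + 2 * J y - 4 * J ((1/2) *\<^sub>R (x + y))"
      unfolding J_def power2_norm_eq_inner f.scaleR f.add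
      by (simp add: inner_add inner_diff inner_commute algebra_simps)
    then show ?thesis using m_le[of "(1/2) *\<^sub>R (x + y)"] by simp
  qed
  have "Cauchy X"
  proof (rule metric_CauchyI)
    fix e :: real assume "e > 0"
    then obtain N where N: "inverse (real (Suc N)) < e\<^sup>2 / 4"
      using reals_Archimedean[of "e\<^sup>2 / 4"] by auto
    have "dist (X i) (X j) < e" if "i \<ge> N" "j \<ge> N" for i j
    proof -
      have "inverse (real (Suc k)) \<le> inverse (real (Suc N))" if "k \<ge> N" for k
        using that by (intro le_imp_inverse_le) auto
      from this[OF that(1)] this[OF that(2)]
      have "J (X i) - m < e\<^sup>2 / 4" "J (X j) - m < e\<^sup>2 / 4"
        using X[of i] X[of j] N by linarith+
      then have "(norm (X i - X j))\<^sup>2 < e\<^sup>2"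
        using parallelogram[of "X i" "X j"] by simp
      then show ?thesis
        using \<open>e > 0\<close> by (simp add: dist_norm power_less_imp_less_base)
    qed
    then show "\<exists>M. \<forall>i\<ge>M. \<forall>j\<ge>M. dist (X i) (X j) < e" by blast
  qed
  then obtain v where v: "X \<longlonglongrightarrow> v" using Cauchy_convergent convergent_def by blast
  have "(\<lambda>n. J (X n)) \<longlonglongrightarrow> J v"
    unfolding J_def using v by (intro tendsto_intros f.tendsto)
  moreover have "(\<lambda>n. m + inverse (real (Suc n))) \<longlonglongrightarrow> m + 0"
    by (intro tendsto_add tendsto_const LIMSEQ_inverse_real_of_nat)
  ultimately have "J v \<le> m + 0"
    using X by (intro LIMSEQ_le) (auto intro: less_imp_le)
  then have v_min: "J v \<le> J x" for x using m_le[of x] by simp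
  have "f x = inner v x" for x
  proof (cases "x = 0")
    case True
    then show ?thesis by (simp add: f.zero)
  next
    case False
    define d where "d = f x - inner v x"
    \<comment> \<open>This \<open>t\<close> minimises the quadratic
      \<open>J (v + t *\<^sub>R x)\<close>, lowering \<open>J v\<close> by \<open>t * d\<close>;
      minimality of \<open>v\<close> forces \<open>d = 0\<close>.\<close>
    define t where "t = d / inner x x"
    have pos: "inner x x > 0" using False by simp
    have "J (v + t *\<^sub>R x) = J v + t * (t * inner x x) - 2 * t * d"
      unfolding J_def d_def f.add f.scaleR
      by (simp add: inner_add inner_commute algebra_simps)
    also have "t * inner x x = d" using pos by (simp add: t_def)
    finally have "t * d \<le> 0" using v_min[of "v + t *\<^sub>R x"] by (simp add: mult.commute)
    then have "d * d \<le> 0" using pos by (simp add: t_def divide_le_0_iff)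
    then show ?thesis by (auto simp: d_def mult_le_0_iff)
  qed
  then show ?thesis by blast
qed

lemma bounded_opD:
  assumes "bounded_op T"
  shows "T (x + y) = T x + T y" "T (x - y) = T x - T y" "T 0 = 0"
    "T (scaleC c x) = scaleC c (T x)"
proof -
  interpret bounded_linear T using assms by (simp add: bounded_op_def)
  show "T (x + y) = T x + T y" "T (x - y) = T x - T y" "T 0 = 0"
    by (simp_all add: add diff zero)
  show "T (scaleC c x) = scaleC c (T x)" using assms by (simp add: bounded_op_def)
qed

lemma bounded_op_id: "bounded_op (\<lambda>x. x)"
  by (simp add: bounded_op_def bounded_linear_ident)

text \<open>\<open>hadj\<close> is a definite description; uniqueness holds because vectors are
  separated by their inner products.\<close>

lemma hadj_eqI:
  assumes "\<And>x y. cinner (T x) y = cinner x (S y)"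
  shows "hadj T = S"
  unfolding hadj_def
proof (rule the_equality)
  show "\<forall>x y. cinner (T x) y = cinner x (S y)" using assms by blast
next
  fix S' assume "\<forall>x y. cinner (T x) y = cinner x (S' y)"
  then show "S' = S" using assms by (intro ext cinner_ext_right) metis
qed

lemma cinner_hadj:
  assumes T: "bounded_op T"
  shows "cinner (T x) y = cinner x (hadj T y)"
proof -
  have "\<exists>v. \<forall>x. cinner (T x) y = cinner x v" for y
  proof -
    have "bounded_linear (\<lambda>x. inner y (T x))"
      using T unfolding bounded_op_def
      by (intro bounded_linear_compose[OF bounded_linear_inner_right]) blast
    from riesz_representation[OF this]
    obtain v where v: "\<And>x. inner y (T x) = inner v x" by blast
    \<comment> \<open>Riesz settles the real part; the imaginary part is the same identity at
      \<open>scaleC \<i> x\<close>, by complex linearity of \<open>T\<close>.\<close>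
    have "cinner (T x) y = cinner x v" for x
      using v[of x] v[of "scaleC \<i> x"] T
      by (simp add: cinner_def bounded_opD inner_commute)
    then show ?thesis by blast
  qed
  then obtain S where S: "\<And>x y. cinner (T x) y = cinner x (S y)" by metis
  with hadj_eqI[of T S] show ?thesis by simp
qed

lemma hadj_hadj:
  assumes "bounded_op T"
  shows "hadj (hadj T) = T"
  by (rule hadj_eqI) (metis assms cinner_hadj cnj_cinner)

lemma bounded_op_hadj:
  assumes T: "bounded_op T"
  shows "bounded_op (hadj T)"
proof -
  have add: "hadj T (x + y) = hadj T x + hadj T y" for x y
    by (rule cinner_ext_right) (simp add: cinner_hadj[OF T, symmetric] cinner_add_right)
  have scale: "hadj T (scaleC c x) = scaleC c (hadj T x)" for c x
    by (rule cinner_ext_right) (simp add: cinner_hadj[OF T, symmetric] cinner_scaleC_right)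
  obtain K where K: "\<And>x. norm (T x) \<le> norm x * K"
    using T unfolding bounded_op_def by (meson bounded_linear.bounded)
  have "norm (hadj T y) \<le> norm y * K" for y
  proof (cases "hadj T y = 0")
    case True
    have "0 \<le> norm y * K" using K[of y] norm_ge_zero order_trans by blast
    then show ?thesis using True by simp
  next
    case False
    \<comment> \<open>Cauchy-Schwarz and the bound for \<open>T\<close> leave one factor
      \<open>norm (hadj T y)\<close> to cancel, so \<open>K\<close> also bounds the adjoint.\<close>
    have "(norm (hadj T y))\<^sup>2 = inner (T (hadj T y)) y"
      using cinner_hadj[OF T, of "hadj T y" y] by (simp add: power2_norm_eq_inner Re_cinner[symmetric])
    also have "\<dots> \<le> norm (T (hadj T y)) * norm y" by (rule norm_cauchy_schwarz)
    also have "\<dots> \<le> norm (hadj T y) * K * norm y" by (intro mult_right_mono K) simp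
    finally show ?thesis using False by (simp add: power2_eq_square mult.assoc mult.commute[of K])
  qed
  moreover have "hadj T (r *\<^sub>R x) = r *\<^sub>R hadj T x" for r x
    using scale[of "of_real r" x] by (simp add: scaleC_of_real)
  ultimately have "bounded_linear (hadj T)"
    using add by (intro bounded_linear_intro) auto
  then show ?thesis using scale by (simp add: bounded_op_def)
qed

section \<open>Rank-one operators\<close>

definition rank_one :: "'a::complex_hilbert \<Rightarrow> 'a \<Rightarrow> 'a \<Rightarrow> 'a" where
  "rank_one x u = (\<lambda>z. scaleC (cinner u z) x)"

lemma bounded_op_rank_one: "bounded_op (rank_one x u)"
proof -
  have "bounded_linear (rank_one x u)"
  proof (rule bounded_linear_intro)
    fix y z :: 'a and r :: real
    show "rank_one x u (y + z) = rank_one x u y + rank_one x u z"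
      by (simp add: rank_one_def cinner_add_right scaleC_add_left)
    show "rank_one x u (r *\<^sub>R y) = r *\<^sub>R rank_one x u y"
      unfolding scaleC_of_real[symmetric]
      by (simp add: rank_one_def cinner_scaleC_right scaleC_scaleC)
    have "norm (rank_one x u y) \<le> 2 * cmod (cinner u y) * norm x"
      unfolding rank_one_def by (rule norm_scaleC_le)
    also have "\<dots> \<le> 2 * (2 * norm u * norm y) * norm x"
      by (intro mult_right_mono mult_left_mono cmod_cinner_le) auto
    finally show "norm (rank_one x u y) \<le> norm y * (4 * norm u * norm x)"
      by (simp add: algebra_simps)
  qed
  then show ?thesis
    by (simp add: bounded_op_def rank_one_def cinner_scaleC_right scaleC_scaleC)
qed

lemma rank_le2_rank_one: "rank_le2 (rank_one x u)"
proof -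
  have "rank_one x u z \<in> cspan {x, x}" for z
    unfolding cspan_def rank_one_def
    by (intro CollectI exI[of _ "{x}"] exI[of _ "\<lambda>_. cinner u z"]) simp
  then show ?thesis using bounded_op_rank_one unfolding rank_le2_def by blast
qed

lemma hadj_rank_one: "hadj (rank_one x u) = rank_one u x"
  by (rule hadj_eqI)
    (simp add: rank_one_def cinner_scaleC_left cinner_scaleC_right cnj_cinner mult.commute)

text \<open>The adjoint moves across the inner product onto \<open>u\<close>. Hence every product in
  the hypothesis with a rank-one left factor is again rank one, with the same range vector.\<close>

lemma rank_one_comp_hadj:
  assumes "bounded_op S"
  shows "rank_one x u \<circ> hadj S = rank_one x (S u)"
  by (simp add: fun_eq_iff rank_one_def cinner_hadj[OF assms])

lemma rank_one_self: "rank_one x u x = scaleC (cinner u x) x"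
  by (simp add: rank_one_def)

lemma rank_one_right_inject:
  assumes "x \<noteq> 0" "rank_one x u = rank_one x v"
  shows "u = v"
proof (rule cinner_ext_left)
  fix z
  have "scaleC (cinner u z - cinner v z) x = 0"
    using fun_cong[OF assms(2), of z] by (simp add: rank_one_def scaleC_diff_left)
  then show "cinner u z = cinner v z" using assms(1) by (simp add: scaleC_eq_0_iff)
qed

text \<open>Pairing \<open>T v\<close> with \<open>x\<close> reads off its coefficient, so the
  functional is given by \<open>hadj T x\<close>, normalised by \<open>cinner x x\<close>. The
  scalar is conjugated because it sits in the conjugate-linear slot.\<close>

lemma range_in_line_imp_rank_one:
  assumes T: "bounded_op T" and "x \<noteq> 0" and range: "\<And>v. \<exists>c. T v = scaleC c x"
  shows "\<exists>u. T = rank_one x u"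
proof (intro exI ext)
  fix v
  obtain c where c: "T v = scaleC c x" using range by blast
  have "cinner (hadj T x) v = cnj (cinner (T v) x)"
    by (simp add: cinner_hadj[OF T] cnj_cinner)
  also have "\<dots> = c * cinner x x" by (simp add: c cinner_scaleC_left cnj_cinner)
  finally show "T v = rank_one x (scaleC (inverse (cnj (cinner x x))) (hadj T x)) v"
    using \<open>x \<noteq> 0\<close> by (simp add: rank_one_def c cinner_scaleC_left cnj_cinner field_simps)
qed

section \<open>Local spectral subspaces\<close>

text \<open>The scalar resolvent times the eigenvector solves the local resolvent equation
  everywhere off \<open>l\<close>.\<close>

lemma eigenvector_in_local_spectral_subspace:
  assumes T: "bounded_op T" and eig: "T x = scaleC l x"
  shows "x \<in> local_spectral_subspace T {l}"
proof -
  define f where "f \<mu> = scaleC (inverse (\<mu> - l)) x" for \<mu>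
  have "analytic_vec_on f (- {l})"
    unfolding analytic_vec_on_def
  proof
    fix \<mu> assume "\<mu> \<in> - {l}"
    then have "((\<lambda>z. inverse (z - l)) has_field_derivative - (inverse (\<mu> - l) * 1 * inverse (\<mu> - l))) (at \<mu>)"
      by (intro DERIV_inverse_fun derivative_eq_intros) auto
    then have "((\<lambda>z. inverse (z - \<mu>) * (inverse (z - l) - inverse (\<mu> - l)))
        \<longlongrightarrow> - (inverse (\<mu> - l) * 1 * inverse (\<mu> - l))) (at \<mu>)"
      by (simp add: has_field_derivative_iff divide_inverse mult.commute)
    from tendsto_scaleC_left[OF this, of x]
    show "\<exists>v. ((\<lambda>z. scaleC (inverse (z - \<mu>)) (f z - f \<mu>)) \<longlongrightarrow> v) (at \<mu>)"
      unfolding f_def scaleC_diff_left[symmetric] scaleC_scaleC by blast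
  qed
  moreover have "scaleC \<mu> (f \<mu>) - T (f \<mu>) = x" if "\<mu> \<in> - {l}" for \<mu>
  proof -
    have "\<mu> * inverse (\<mu> - l) - inverse (\<mu> - l) * l = (\<mu> - l) * inverse (\<mu> - l)"
      by (simp add: left_diff_distrib mult.commute)
    also have "\<dots> = 1" using that by simp
    finally have "\<mu> * inverse (\<mu> - l) - inverse (\<mu> - l) * l = 1" .
    then show ?thesis
      unfolding f_def bounded_opD(4)[OF T] eig scaleC_scaleC scaleC_diff_left[symmetric] by simp
  qed
  ultimately have "- {l} \<subseteq> local_resolvent T x"
    unfolding local_resolvent_def by (intro Union_upper CollectI conjI exI[of _ f]) auto
  then show ?thesis
    by (auto simp: local_spectral_subspace_def local_spectrum_def)
qed

lemma analytic_vec_on_tendsto: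
  assumes "analytic_vec_on f U" "\<mu> \<in> U"
  shows "(f \<longlongrightarrow> f \<mu>) (at \<mu>)"
proof -
  obtain v where v: "((\<lambda>z. scaleC (inverse (z - \<mu>)) (f z - f \<mu>)) \<longlongrightarrow> v) (at \<mu>)"
    using assms by (auto simp: analytic_vec_on_def)
  have "((\<lambda>z. z - \<mu>) \<longlongrightarrow> \<mu> - \<mu>) (at \<mu>)" by (intro tendsto_intros)
  then have "((\<lambda>z. z - \<mu>) \<longlongrightarrow> 0) (at \<mu>)" by simp
  from tendsto_scaleC_zero[OF this v]
  have "((\<lambda>z. f z - f \<mu>) \<longlongrightarrow> 0) (at \<mu>)"
    by (rule Lim_transform_eventually)
      (auto simp: eventually_at_filter scaleC_scaleC)
  then show ?thesis by (simp add: LIM_zero_iff)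
qed

text \<open>As \<open>l \<noteq> 0\<close>, the resolvent equation can be solved near 0, and its
  value at 0 puts \<open>z\<close> on the line through \<open>x\<close>. If
  \<open>cinner w x\<close> differed from \<open>l\<close>, the equation could also be solved at
  that point, which leads to \<open>z = 0\<close>.\<close>

lemma local_spectral_subspace_rank_one:
  assumes z: "z \<in> local_spectral_subspace (rank_one x w) {l}" and "l \<noteq> 0"
  shows "\<exists>c. z = scaleC c x" and "z \<noteq> 0 \<Longrightarrow> cinner w x = l"
proof -
  have res: "\<exists>U f. open U \<and> \<mu> \<in> U \<and> analytic_vec_on f U \<and>
      (\<forall>\<mu>\<in>U. scaleC \<mu> (f \<mu>) - scaleC (cinner w (f \<mu>)) x = z)" if "\<mu> \<noteq> l" for \<mu>
    using z that unfolding local_spectral_subspace_def local_spectrum_def local_resolvent_def rank_one_def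
    by blast
  obtain U f where U: "open U" "0 \<in> U" and f: "analytic_vec_on f U"
    and eq: "\<And>\<mu>. \<mu> \<in> U \<Longrightarrow> scaleC \<mu> (f \<mu>) - scaleC (cinner w (f \<mu>)) x = z"
    using res[of 0] \<open>l \<noteq> 0\<close> by metis
  have z_eq: "z = scaleC (- cinner w (f 0)) x"
    using eq[OF U(2)] by (simp add: scaleC_minus_left)
  then show "\<exists>c. z = scaleC c x" by blast
  assume "z \<noteq> 0"
  show "cinner w x = l"
  proof (rule ccontr)
    assume neq: "cinner w x \<noteq> l"
    obtain g where "scaleC (cinner w x) g - scaleC (cinner w g) x = z"
      using res[OF neq] by blast
    \<comment> \<open>Pairing the equation at \<open>\<mu> = cinner w x\<close> with
      \<open>w\<close> makes its two terms cancel.\<close>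
    then have "cinner w z = 0"
      by (auto simp: cinner_diff_right cinner_scaleC_right)
    with z_eq \<open>z \<noteq> 0\<close> have wx: "cinner w x = 0"
      by (auto simp: cinner_scaleC_right)
    \<comment> \<open>Pairing with \<open>w\<close> now leaves
      \<open>\<mu> * cinner w (f \<mu>) = 0\<close>; the value at 0, which determines
      \<open>z\<close>, follows by continuity of \<open>f\<close>.\<close>
    have "cinner w (f \<mu>) = 0" if "\<mu> \<in> U" "\<mu> \<noteq> 0" for \<mu>
      using arg_cong[OF eq[OF that(1)], of "cinner w"] that(2) wx \<open>cinner w z = 0\<close>
      by (simp add: cinner_diff_right cinner_scaleC_right)
    then have "\<forall>\<^sub>F \<mu> in at 0. cinner w (f \<mu>) = 0"
      using U eventually_at_topological by blast
    then have "((\<lambda>\<mu>. cinner w (f \<mu>)) \<longlongrightarrow> 0) (at 0)"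
      by (rule tendsto_eventually)
    moreover have "((\<lambda>\<mu>. cinner w (f \<mu>)) \<longlongrightarrow> cinner w (f 0)) (at 0)"
      by (intro tendsto_cinner analytic_vec_on_tendsto[OF f U(2)])
    ultimately have "cinner w (f 0) = 0"
      using LIM_unique by blast
    then show False using z_eq \<open>z \<noteq> 0\<close> by simp
  qed
qed

lemma local_spectral_subspace_rank_one_eq_imp:
  assumes "x \<noteq> 0"
    and eq: "\<And>l. local_spectral_subspace (rank_one x v) {l} = local_spectral_subspace (rank_one x w) {l}"
  shows "cinner v x = cinner w x"
proof -
  have *: "cinner b x = cinner a x"
    if "\<And>l. local_spectral_subspace (rank_one x a) {l} = local_spectral_subspace (rank_one x b) {l}"
      "cinner a x \<noteq> 0" for a b
  proof -
    have "x \<in> local_spectral_subspace (rank_one x a) {cinner a x}"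
      by (rule eigenvector_in_local_spectral_subspace[OF bounded_op_rank_one rank_one_self])
    then show ?thesis
      using local_spectral_subspace_rank_one(2)[of x x b "cinner a x"] that \<open>x \<noteq> 0\<close> by simp
  qed
  \<comment> \<open>If either number is nonzero, \<open>*\<close> applies in that order; otherwise
    both vanish.\<close>
  show ?thesis using *[of v w] *[of w v] eq by metis
qed

text \<open>Infinite dimension enters through this fact; with \<open>x = 0\<close> it provides a
  nonzero vector.\<close>

lemma exists_not_in_line:
  assumes "infinite_dimensional TYPE('a::complex_hilbert)"
  shows "\<exists>y::'a. \<forall>c. y \<noteq> scaleC c x"
proof -
  have "cspan {x} \<noteq> UNIV" using assms by (simp add: infinite_dimensional_def)
  then obtain y where y: "y \<notin> cspan {x}" by blast
  have "scaleC c x \<in> cspan {x}" for c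
    unfolding cspan_def by (intro CollectI exI[of _ "{x}"] exI[of _ "\<lambda>_. c"]) simp
  then show ?thesis using y by metis
qed

lemma exists_separating_vector:
  assumes "\<And>c. x \<noteq> scaleC c z"
  shows "\<exists>p. cinner p z = 0 \<and> cinner p x \<noteq> 0"
proof -
  \<comment> \<open>Gram-Schmidt: \<open>p\<close> is the part of \<open>x\<close> orthogonal to
    \<open>z\<close>. For \<open>z = 0\<close> division by zero gives \<open>c = 0\<close>, so
    \<open>p = x\<close>.\<close>
  define c where "c = cinner z x / cinner z z"
  define p where "p = x - scaleC c z"
  have "p \<noteq> 0" using assms[of c] by (simp add: p_def)
  have "cinner z p = 0"
    by (cases "z = 0") (simp_all add: p_def c_def cinner_diff_right cinner_scaleC_right)
  then have pz: "cinner p z = 0" by (metis cnj_cinner complex_cnj_zero)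
  have "cinner p p = cinner p x - c * cinner p z"
    by (subst (2) p_def) (simp add: cinner_diff_right cinner_scaleC_right)
  then show ?thesis using pz \<open>p \<noteq> 0\<close> by (metis cinner_self_eq_0 diff_zero mult_zero_right)
qed

section \<open>Maps preserving local spectral subspaces\<close>

locale local_spectral_preserver =
  fixes \<phi> :: "('a::complex_hilbert \<Rightarrow> 'a) \<Rightarrow> ('a \<Rightarrow> 'a)"
  assumes bounded: "bounded_op T \<Longrightarrow> bounded_op (\<phi> T)"
    and onto_rank_one: "\<exists>T. bounded_op T \<and> \<phi> T = rank_one x u"
    and preserves: "bounded_op T \<Longrightarrow> bounded_op S \<Longrightarrow>
      local_spectral_subspace (\<phi> T \<circ> hadj (\<phi> S)) {l} = local_spectral_subspace (T \<circ> hadj S) {l}"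
begin

text \<open>For \<open>y = T v \<noteq> 0\<close>, the choice \<open>S = rank_one y v\<close> turns
  \<open>T \<circ> hadj S\<close> into \<open>rank_one y y\<close>, with eigenvector
  \<open>y\<close>. On the other side stands a rank-one operator with range in the line through
  \<open>x\<close>, so \<open>y\<close> lies there.\<close>

lemma preimage_range_in_line:
  assumes T: "bounded_op T" and phi_T: "\<phi> T = rank_one x u"
  shows "\<exists>c. T v = scaleC c x"
proof (cases "T v = 0")
  case True
  then show ?thesis by (metis scaleC_0_left)
next
  case False
  define y where "y = T v"
  let ?S = "rank_one y v"
  have "T (hadj ?S z) = rank_one y y z" for z
    unfolding hadj_rank_one by (simp add: rank_one_def bounded_opD[OF T] y_def)
  then have TS: "T \<circ> hadj ?S = rank_one y y" by auto
  have "y \<in> local_spectral_subspace (T \<circ> hadj ?S) {cinner y y}"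
    unfolding TS
    by (rule eigenvector_in_local_spectral_subspace[OF bounded_op_rank_one rank_one_self])
  then have "y \<in> local_spectral_subspace (rank_one x (\<phi> ?S u)) {cinner y y}"
    using preserves[OF T bounded_op_rank_one] rank_one_comp_hadj[OF bounded[OF bounded_op_rank_one]]
    by (metis phi_T)
  moreover have "cinner y y \<noteq> 0" using False by (simp add: y_def)
  ultimately show ?thesis
    using local_spectral_subspace_rank_one(1) unfolding y_def by blast
qed

lemma rank_one_preimage:
  assumes "x \<noteq> 0"
  shows "\<exists>u'. \<phi> (rank_one x u') = rank_one x u \<and>
    (\<forall>S. bounded_op S \<longrightarrow> cinner (\<phi> S u) x = cinner (S u') x)"
proof -
  obtain T where T: "bounded_op T" "\<phi> T = rank_one x u" using onto_rank_one by blast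
  obtain u' where u': "T = rank_one x u'"
    using range_in_line_imp_rank_one[OF T(1) assms preimage_range_in_line[OF T]] by blast
  have "cinner (\<phi> S u) x = cinner (S u') x" if S: "bounded_op S" for S
  proof (rule local_spectral_subspace_rank_one_eq_imp[OF assms])
    show "local_spectral_subspace (rank_one x (\<phi> S u)) {l} = local_spectral_subspace (rank_one x (S u')) {l}" for l
      using preserves[OF T(1) S, of l]
      unfolding T(2) rank_one_comp_hadj[OF bounded[OF S]]
      unfolding u' rank_one_comp_hadj[OF S] .
  qed
  then show ?thesis using T(2) u' by blast
qed

text \<open>The vector \<open>u'\<close> belonging to \<open>x\<close> and \<open>u\<close>; its
  properties are guaranteed only for \<open>x \<noteq> 0\<close>.\<close>

definition pre :: "'a \<Rightarrow> 'a \<Rightarrow> 'a" where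
  "pre x u = (SOME u'. \<phi> (rank_one x u') = rank_one x u \<and>
    (\<forall>S. bounded_op S \<longrightarrow> cinner (\<phi> S u) x = cinner (S u') x))"

lemma pre:
  assumes "x \<noteq> 0"
  shows "\<phi> (rank_one x (pre x u)) = rank_one x u"
    and "bounded_op S \<Longrightarrow> cinner (\<phi> S u) x = cinner (S (pre x u)) x"
  using someI_ex[OF rank_one_preimage[OF assms, of u]] unfolding pre_def by blast+

text \<open>The pairing of \<open>\<phi> S u\<close> with \<open>x\<close> is additive in
  \<open>x\<close>, hence so is that of \<open>S (pre x u)\<close>. A rank-one \<open>S\<close>
  whose range is orthogonal to \<open>z\<close> but not to \<open>x\<close> isolates
  \<open>pre x u\<close>.\<close>

lemma pre_add:
  assumes "x \<noteq> 0" and "z \<noteq> 0" and indep: "\<And>c. x \<noteq> scaleC c z"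
  shows "pre (x + z) u = pre x u"
proof -
  obtain p where p: "cinner p z = 0" "cinner p x \<noteq> 0"
    using exists_separating_vector[OF indep] by blast
  have "x + z \<noteq> 0" using indep[of "-1"] by (auto simp: scaleC_minus_left add_eq_0_iff2)
  show ?thesis
  proof (rule cinner_ext_left)
    fix q
    let ?S = "rank_one p q"
    have "cinner (?S (pre (x + z) u)) (x + z) = cinner (?S (pre x u)) x + cinner (?S (pre z u)) z"
      using pre(2)[OF \<open>x + z \<noteq> 0\<close> bounded_op_rank_one] pre(2)[OF \<open>x \<noteq> 0\<close> bounded_op_rank_one]
        pre(2)[OF \<open>z \<noteq> 0\<close> bounded_op_rank_one]
      by (metis cinner_add_right)
    then show "cinner (pre (x + z) u) q = cinner (pre x u) q"
      using p by (simp add: rank_one_def cinner_scaleC_left cinner_add_right cnj_cinner)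
  qed
qed

text \<open>By symmetry \<open>pre (x + z) u\<close> equals both sides.\<close>

lemma pre_eq_of_indep:
  assumes "x \<noteq> 0" and "z \<noteq> 0" and indep: "\<And>c. x \<noteq> scaleC c z"
  shows "pre x u = pre z u"
proof -
  have "z \<noteq> scaleC c x" for c
  proof
    assume "z = scaleC c x"
    then have "c \<noteq> 0" "scaleC (inverse c) z = x"
      using \<open>z \<noteq> 0\<close> by (auto simp: scaleC_scaleC scaleC_eq_0_iff)
    then show False using indep by metis
  qed
  then show ?thesis
    using pre_add[OF assms] pre_add[OF assms(2,1)] by (metis add.commute)
qed

lemma pre_eq:
  assumes "infinite_dimensional TYPE('a)" and "x \<noteq> 0" and "z \<noteq> 0"
  shows "pre x u = pre z u"
proof (cases "\<exists>c. x = scaleC c z")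
  case False
  then show ?thesis using pre_eq_of_indep assms by blast
next
  case True
  then obtain c where c: "x = scaleC c z" by blast
  \<comment> \<open>Parallel vectors are compared through a third one off their common line.\<close>
  obtain y where y: "\<And>c. y \<noteq> scaleC c z"
    using exists_not_in_line[OF assms(1), of z] by blast
  have "y \<noteq> 0" using y[of 0] by simp
  have "y \<noteq> scaleC d x" for d using y[of "d * c"] by (simp add: c scaleC_scaleC)
  then show ?thesis
    using pre_eq_of_indep[of y x u] pre_eq_of_indep[of y z u] y \<open>y \<noteq> 0\<close> assms by metis
qed

section \<open>Factorisation of \<open>\<phi>\<close> through the image of the identity\<close>

lemma pre_eq_phi_id:
  assumes "infinite_dimensional TYPE('a)" and "x \<noteq> 0"
  shows "pre x u = \<phi> (\<lambda>x. x) u"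
proof (rule cinner_ext_left)
  fix z
  show "cinner (pre x u) z = cinner (\<phi> (\<lambda>x. x) u) z"
    using pre(2)[OF _ bounded_op_id, of z u] pre_eq[OF assms(1), of z x u] assms(2)
    by (cases "z = 0") auto
qed

lemma phi_eq_comp:
  assumes "infinite_dimensional TYPE('a)" and "bounded_op S"
  shows "\<phi> S u = S (\<phi> (\<lambda>x. x) u)"
proof (rule cinner_ext_left)
  fix z
  show "cinner (\<phi> S u) z = cinner (S (\<phi> (\<lambda>x. x) u)) z"
    using pre(2)[of z S u] pre_eq_phi_id[OF assms(1), of z u] assms(2)
    by (cases "z = 0") auto
qed

section \<open>Unitarity of the image of the identity\<close>

lemma phi_id_isometry:
  assumes "infinite_dimensional TYPE('a)"
  shows "hadj (\<phi> (\<lambda>x. x)) (\<phi> (\<lambda>x. x) u) = u"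
proof -
  obtain x :: 'a where x: "x \<noteq> 0" using exists_not_in_line[OF assms, of 0] by auto
  let ?A = "\<phi> (\<lambda>x. x)"
  have A: "bounded_op ?A" by (rule bounded[OF bounded_op_id])
  \<comment> \<open>Both sides are \<open>\<phi> (rank_one x (?A u)) z\<close>: the left because
    \<open>pre x u = ?A u\<close>, the right by the factorisation.\<close>
  have "rank_one x u z = rank_one x (?A u) (?A z)" for z
    using pre(1)[OF x, of u] phi_eq_comp[OF assms bounded_op_rank_one, of x "?A u" z]
    by (simp add: pre_eq_phi_id[OF assms x])
  also have "\<dots> z = rank_one x (hadj ?A (?A u)) z" for z
  proof -
    have "cinner (?A u) (?A z) = cinner (hadj ?A (?A u)) z"
      by (metis cinner_hadj[OF A] cnj_cinner)
    then show ?thesis by (simp add: rank_one_def)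
  qed
  finally show ?thesis using rank_one_right_inject[OF x] by (metis ext)
qed

text \<open>Injectivity on the operators \<open>rank_one w w\<close>: for
  \<open>w \<noteq> 0\<close>, \<open>w\<close> is an eigenvector of
  \<open>?T \<circ> hadj ?T\<close> with nonzero eigenvalue, whereas the zero operator has trivial
  local spectral subspace there.\<close>

lemma phi_rank_one_eq_0:
  assumes "\<phi> (rank_one w w) = (\<lambda>z. 0)"
  shows "w = 0"
proof (rule ccontr)
  assume "w \<noteq> 0"
  let ?T = "rank_one w w"
  let ?l = "cinner (?T w) w"
  have l: "?l \<noteq> 0"
    using \<open>w \<noteq> 0\<close> by (simp add: rank_one_def cinner_scaleC_left)
  have "w \<in> local_spectral_subspace (?T \<circ> hadj ?T) {?l}"
    unfolding rank_one_comp_hadj[OF bounded_op_rank_one]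
    by (rule eigenvector_in_local_spectral_subspace[OF bounded_op_rank_one rank_one_self])
  also have "\<dots> = local_spectral_subspace (\<phi> ?T \<circ> hadj (\<phi> ?T)) {?l}"
    by (rule preserves[OF bounded_op_rank_one bounded_op_rank_one, symmetric])
  also have "\<phi> ?T \<circ> hadj (\<phi> ?T) = rank_one 0 0"
    unfolding assms by (simp add: rank_one_def fun_eq_iff)
  finally show False
    using local_spectral_subspace_rank_one(2)[of w 0 0 ?l] l \<open>w \<noteq> 0\<close> by simp
qed

lemma phi_id_coisometry:
  assumes "infinite_dimensional TYPE('a)"
  shows "\<phi> (\<lambda>x. x) (hadj (\<phi> (\<lambda>x. x)) y) = y"
proof -
  let ?A = "\<phi> (\<lambda>x. x)"
  have A: "bounded_op ?A" by (rule bounded[OF bounded_op_id])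
  \<comment> \<open>\<open>w\<close> is the part of \<open>y\<close> orthogonal to the range of
    \<open>?A\<close>, so \<open>rank_one w w\<close> composed with \<open>?A\<close>
    vanishes.\<close>
  define w where "w = y - ?A (hadj ?A y)"
  have "hadj ?A w = 0"
    by (simp add: w_def bounded_opD[OF bounded_op_hadj[OF A]] phi_id_isometry[OF assms])
  then have "cinner w (?A z) = 0" for z
    by (metis cinner_hadj[OF A] cnj_cinner cinner_0_right complex_cnj_zero)
  then have "\<phi> (rank_one w w) = (\<lambda>z. 0)"
    using phi_eq_comp[OF assms bounded_op_rank_one, of w w] by (simp add: rank_one_def fun_eq_iff)
  then show ?thesis using phi_rank_one_eq_0[of w] by (simp add: w_def)
qed

end

theorem theorem3p1:
  fixes \<phi> :: "('a::complex_hilbert \<Rightarrow> 'a) \<Rightarrow> ('a \<Rightarrow> 'a)"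
  assumes "infinite_dimensional TYPE('a)"
    and "\<forall>T. bounded_op T \<longrightarrow> bounded_op (\<phi> T)"
    and "\<forall>T S. bounded_op T \<longrightarrow> bounded_op S \<longrightarrow> \<phi> (\<lambda>x. T x + S x) = (\<lambda>x. \<phi> T x + \<phi> S x)"
    and "\<forall>F. rank_le2 F \<longrightarrow> (\<exists>T. bounded_op T \<and> \<phi> T = F)"
    and "\<forall>T S l. bounded_op T \<longrightarrow> bounded_op S \<longrightarrow>
           local_spectral_subspace (\<phi> T \<circ> hadj (\<phi> S)) {l}
             = local_spectral_subspace (T \<circ> hadj S) {l}"
  shows "\<exists>V \<mu>. unitary V \<and> \<mu> \<noteq> 0 \<and>
           (\<forall>T. bounded_op T \<longrightarrow> \<phi> T = (\<lambda>x. scaleC \<mu> (T (hadj V x))))"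
proof -
  interpret local_spectral_preserver \<phi>
    using assms(2,4,5) rank_le2_rank_one by unfold_locales blast+
  let ?A = "\<phi> (\<lambda>x. x)"
  have A: "bounded_op ?A" by (rule bounded[OF bounded_op_id])
  \<comment> \<open>Since \<open>\<phi> T\<close> is \<open>T\<close> after \<open>?A\<close>, the
    witnesses are \<open>V = hadj ?A\<close> and \<open>\<mu> = 1\<close>.\<close>
  have "unitary (hadj ?A)"
    using bounded_op_hadj[OF A] phi_id_isometry[OF assms(1)] phi_id_coisometry[OF assms(1)]
    by (simp add: unitary_def hadj_hadj[OF A] fun_eq_iff)
  moreover have "\<phi> T = (\<lambda>x. scaleC 1 (T (hadj (hadj ?A) x)))" if "bounded_op T" for T
    using phi_eq_comp[OF assms(1) that] by (simp add: hadj_hadj[OF A] fun_eq_iff)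
  ultimately show ?thesis using zero_neq_one by metis
qed

end
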